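(* If $n$ is a positive integer and $S$ is a subset of $\mathbb{R}^n$, then the lattice $\mathrm{RelConv}(S)$ satisfies the identity $((D_n)\vee z)\wedge y_1\wedge y_2$, and if $p$ is a point of $S$, the lattice $\mathrm{RelConv}(S)_{\geq\{p\}}$ satisfies the identity $D_n$.
   Context: For $S\subseteq\mathbb{R}^n$ (not necessarily convex), a subset $x\subseteq S$ is convex relative to $S$ if $x=\mathrm{c.h.}(x)\cap S$, where $\mathrm{c.h.}$ denotes convex hull in $\mathbb{R}^n$. $\mathrm{RelConv}(S)$ is the lattice of all such sets $x$, ordered by inclusion, with $x\wedge y=x\cap y$ and $x\vee y=\mathrm{c.h.}(x\cup y)\cap S$. $\mathrm{RelConv}(S)_{\geq\{p\}}$ is the sublattice of those members containing $p$. For a positive integer $n$, $D_n(x,y_1,\dots,y_{n+1})$ is the lattice relation $$x\wedge\Big(\bigvee_{i=1}^{n+1}y_i\Big)=\bigvee_{i=1}^{n+1}\Big(x\wedge\bigvee_{j\neq i}y_j\Big),$$ and a lattice satisfies the identity $D_n$ if this holds for all choices of elements. The identity $((D_n)\vee z)\wedge y_1\wedge y_2$, in the variables $x,y_1,\dots,y_{n+1},z$, is obtained by applying the operation $((-)\vee z)\wedge y_1\wedge y_2$ to both sides of $D_n$: $$\Big(\Big(x\wedge\bigvee_i y_i\Big)\vee z\Big)\wedge y_1\wedge y_2=\Big(\bigvee_i\Big(x\wedge\bigvee_{j\neq i}y_j\Big)\vee z\Big)\wedge y_1\wedge y_2 .$$ *)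

theory Defs
  imports "HOL-Analysis.Analysis" "HOL-Algebra.Lattice"
begin

definition rel_convex :: "'a::real_vector set \<Rightarrow> 'a set \<Rightarrow> bool" where
  "rel_convex S x \<longleftrightarrow> x \<subseteq> S \<and> x = convex hull x \<inter> S"

definition RelConv :: "'a::real_vector set \<Rightarrow> 'a set gorder" where
  "RelConv S = \<lparr>carrier = {x. rel_convex S x}, eq = (=), le = (\<subseteq>)\<rparr>"

definition RelConv_ge :: "'a::real_vector set \<Rightarrow> 'a set \<Rightarrow> 'a set gorder" where
  "RelConv_ge S a = RelConv S\<lparr>carrier := {x \<in> carrier (RelConv S). a \<subseteq> x}\<rparr>"

text \<open>
  The lattice operations are the library ones, derived from the order and the carrier.
  The next lemmas confirm that in \<^term>\<open>RelConv S\<close> and, for \<open>a \<subseteq> S\<close>, in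
  \<^term>\<open>RelConv_ge S a\<close> they are the intersection and the convex hull of the union cut
  down to \<open>S\<close>; in particular the latter is a sublattice of the former.
\<close>

lemma RelConv_ge_empty: "RelConv_ge S {} = RelConv S"
  by (simp add: RelConv_ge_def RelConv_def)

lemma carrier_RelConv_ge: "x \<in> carrier (RelConv_ge S a) \<longleftrightarrow> rel_convex S x \<and> a \<subseteq> x"
  by (simp add: RelConv_ge_def RelConv_def)

lemma le_RelConv_ge: "x \<sqsubseteq>\<^bsub>RelConv_ge S a\<^esub> y \<longleftrightarrow> x \<subseteq> y"
  by (simp add: RelConv_ge_def RelConv_def)

lemma rel_convex_hull: "rel_convex S (convex hull A \<inter> S)"
proof -
  have "convex hull (convex hull A \<inter> S) \<subseteq> convex hull A"
    by (simp add: hull_minimal)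
  then show ?thesis
    unfolding rel_convex_def using hull_subset[of "convex hull A \<inter> S" convex] by blast
qed

lemma rel_convex_Int:
  assumes "rel_convex S x" "rel_convex S y"
  shows "rel_convex S (x \<inter> y)"
proof -
  have "convex hull (x \<inter> y) \<subseteq> convex hull x" "convex hull (x \<inter> y) \<subseteq> convex hull y"
    by (simp_all add: hull_mono)
  then show ?thesis
    using assms hull_subset[of "x \<inter> y" convex] unfolding rel_convex_def by blast
qed

lemma partial_order_RelConv_ge: "partial_order (RelConv_ge S a)"
  by unfold_locales (auto simp: RelConv_ge_def RelConv_def)

lemma least_RelConv_ge:
  assumes "A \<subseteq> carrier (RelConv_ge S a)" "A \<noteq> {}"
  shows "least (RelConv_ge S a) (convex hull (\<Union>A) \<inter> S) (Upper (RelConv_ge S a) A)"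
proof -
  have A: "\<And>x. x \<in> A \<Longrightarrow> rel_convex S x \<and> a \<subseteq> x"
    using assms(1) carrier_RelConv_ge by blast
  have up: "x \<subseteq> convex hull (\<Union>A) \<inter> S" if "x \<in> A" for x
    using A[OF that] that hull_subset[of "\<Union>A" convex] unfolding rel_convex_def by blast
  have "convex hull (\<Union>A) \<inter> S \<subseteq> u" if "rel_convex S u" "\<And>x. x \<in> A \<Longrightarrow> x \<subseteq> u" for u
    using hull_mono[of "\<Union>A" u convex] that unfolding rel_convex_def by blast
  then have "convex hull (\<Union>A) \<inter> S \<subseteq> u"
    if "rel_convex S u" "\<forall>x. x \<in> A \<and> rel_convex S x \<and> a \<subseteq> x \<longrightarrow> x \<subseteq> u" for u
    using A that by blast
  moreover have "a \<subseteq> convex hull (\<Union>A) \<inter> S"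
    using A up assms(2) by blast
  ultimately show ?thesis
    unfolding least_def Upper_def
    using up A by (auto simp: carrier_RelConv_ge le_RelConv_ge rel_convex_hull)
qed

lemma greatest_RelConv_ge:
  assumes "x \<in> carrier (RelConv_ge S a)" "y \<in> carrier (RelConv_ge S a)"
  shows "greatest (RelConv_ge S a) (x \<inter> y) (Lower (RelConv_ge S a) {x, y})"
  using assms
  by (auto simp: greatest_def Lower_def carrier_RelConv_ge le_RelConv_ge rel_convex_Int)

lemma lattice_RelConv_ge: "lattice (RelConv_ge S a)"
proof -
  interpret partial_order "RelConv_ge S a"
    by (rule partial_order_RelConv_ge)
  show ?thesis
  proof
    fix x y assume xy: "x \<in> carrier (RelConv_ge S a)" "y \<in> carrier (RelConv_ge S a)"
    show "\<exists>s. least (RelConv_ge S a) s (Upper (RelConv_ge S a) {x, y})"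
      using least_RelConv_ge[of "{x, y}"] xy by blast
    show "\<exists>s. greatest (RelConv_ge S a) s (Lower (RelConv_ge S a) {x, y})"
      using greatest_RelConv_ge[OF xy] by blast
  qed
qed

lemma sup_RelConv_ge:
  assumes "A \<subseteq> carrier (RelConv_ge S a)" "A \<noteq> {}"
  shows "\<Squnion>\<^bsub>RelConv_ge S a\<^esub> A = convex hull (\<Union>A) \<inter> S"
  unfolding Lattice.sup_def
  using least_RelConv_ge[OF assms] partial_order.least_unique[OF partial_order_RelConv_ge]
  by (metis someI)

lemma join_RelConv_ge:
  assumes "x \<in> carrier (RelConv_ge S a)" "y \<in> carrier (RelConv_ge S a)"
  shows "x \<squnion>\<^bsub>RelConv_ge S a\<^esub> y = convex hull (x \<union> y) \<inter> S"
  unfolding join_def using sup_RelConv_ge[of "{x, y}"] assms by simp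

lemma meet_RelConv_ge:
  assumes "x \<in> carrier (RelConv_ge S a)" "y \<in> carrier (RelConv_ge S a)"
  shows "x \<sqinter>\<^bsub>RelConv_ge S a\<^esub> y = x \<inter> y"
  unfolding meet_def Lattice.inf_def
  using greatest_RelConv_ge[OF assms] partial_order.greatest_unique[OF partial_order_RelConv_ge]
  by (metis someI)

lemmas lattice_RelConv = lattice_RelConv_ge[where a = "{}", unfolded RelConv_ge_empty]
  and sup_RelConv = sup_RelConv_ge[where a = "{}", unfolded RelConv_ge_empty]
  and join_RelConv = join_RelConv_ge[where a = "{}", unfolded RelConv_ge_empty]
  and meet_RelConv = meet_RelConv_ge[where a = "{}", unfolded RelConv_ge_empty]

text \<open>
  The two sides of \<open>D\<^sub>n(x, y\<^sub>1, \<dots>, y\<^sub>n\<^sub>+\<^sub>1)\<close>. Only the values of \<open>y\<close> at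
  \<open>1, \<dots>, n + 1\<close> matter. For \<open>n \<ge> 1\<close> all families joined here are nonempty.
\<close>

definition D_lhs :: "('a, 'b) gorder_scheme \<Rightarrow> nat \<Rightarrow> 'a \<Rightarrow> (nat \<Rightarrow> 'a) \<Rightarrow> 'a" where
  "D_lhs L n x y = x \<sqinter>\<^bsub>L\<^esub> (SSUP\<^bsub>L\<^esub> i:{1..n+1}. y i)"

definition D_rhs :: "('a, 'b) gorder_scheme \<Rightarrow> nat \<Rightarrow> 'a \<Rightarrow> (nat \<Rightarrow> 'a) \<Rightarrow> 'a" where
  "D_rhs L n x y = (SSUP\<^bsub>L\<^esub> i:{1..n+1}. x \<sqinter>\<^bsub>L\<^esub> (SSUP\<^bsub>L\<^esub> j:{1..n+1} - {i}. y j))"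

definition satisfies_D :: "('a, 'b) gorder_scheme \<Rightarrow> nat \<Rightarrow> bool" where
  "satisfies_D L n \<longleftrightarrow>
    (\<forall>x \<in> carrier L. \<forall>y \<in> {1..n+1} \<rightarrow> carrier L. D_lhs L n x y = D_rhs L n x y)"

definition satisfies_D_join_meet :: "('a, 'b) gorder_scheme \<Rightarrow> nat \<Rightarrow> bool" where
  "satisfies_D_join_meet L n \<longleftrightarrow>
    (\<forall>x \<in> carrier L. \<forall>y \<in> {1..n+1} \<rightarrow> carrier L. \<forall>z \<in> carrier L.
      (D_lhs L n x y \<squnion>\<^bsub>L\<^esub> z) \<sqinter>\<^bsub>L\<^esub> y 1 \<sqinter>\<^bsub>L\<^esub> y 2 =
      (D_rhs L n x y \<squnion>\<^bsub>L\<^esub> z) \<sqinter>\<^bsub>L\<^esub> y 1 \<sqinter>\<^bsub>L\<^esub> y 2)"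

end

theory Submission
  imports Defs
begin

text \<open>
  If \<open>b\<close> belongs to the convex hull of every union of all but one of \<open>n + 1\<close> subsets of
  \<open>\<real>\<^sup>n\<close>, then so does every point of the convex hull of the whole union for at least one
  choice of the omitted set. Indeed, by Caratheodory such a point is a convex combination of at
  most \<open>n + 1\<close> points of the union, and a Radon partition of these together with \<open>b\<close> allows one
  of them to be traded for \<open>b\<close>; the \<open>n\<close> remaining ones miss one of the sets. The common point
  \<open>p\<close>, or any point of \<open>y\<^sub>1 \<inter> y\<^sub>2\<close>, serves as \<open>b\<close>. If \<open>y\<^sub>1 \<inter> y\<^sub>2\<close> is empty, both sides of
  the first identity are empty.
\<close>

text \<open>No position of \<open>b\<close> relative to \<open>T\<close> is assumed. Radon gives a
  point \<open>c\<close> in the hulls of disjoint parts \<open>M\<close> and \<open>P\<close>, with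
  \<open>b\<close> outside \<open>M\<close>. A vertex of \<open>M\<close> is traded for
  \<open>c\<close>, and \<open>c\<close> is expressed through \<open>P\<close>, whose points are
  \<open>b\<close> or remaining points of \<open>T\<close>.\<close>

lemma in_convex_hull_exchange_any:
  fixes a b :: "'a::euclidean_space"
  assumes "finite T" "DIM('a) < card T" "a \<in> convex hull T"
  obtains t where "t \<in> T" "a \<in> convex hull (insert b (T - {t}))"
proof (cases "b \<in> T")
  case True
  then show ?thesis
    using that[of b] assms(3) by (simp add: insert_absorb)
next
  case False
  \<comment> \<open>Affine independence allows at most \<open>DIM('a) + 1\<close> points;
    \<open>insert b T\<close> has at least one more.\<close>
  have "affine_dependent (insert b T)"
    using assms(1,2) False by (intro affine_dependent_biggerset) auto
  \<comment> \<open>The Radon parts are disjoint, so at least one of them misses \<open>b\<close>;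
    that one is named \<open>M\<close>.\<close>
  then obtain M P where MP: "M \<subseteq> insert b T" "P \<subseteq> insert b T" "M \<inter> P = {}"
      "convex hull M \<inter> convex hull P \<noteq> {}" "b \<notin> M"
    by (rule Radon) (metis Int_commute disjoint_iff)
  then obtain c where c: "c \<in> convex hull M" "c \<in> convex hull P"
    by blast
  have MT: "M \<subseteq> T"
    using MP by blast
  have "M \<noteq> {}"
    using c by auto
  \<comment> \<open>The weights on \<open>M\<close> are merged into a single point \<open>m\<close>,
    so that only \<open>m\<close> has to be rewritten.\<close>
  have "\<exists>m \<in> convex hull M. a \<in> convex hull (insert m (T - M))"
  proof (cases "T - M = {}")
    case True
    then show ?thesis
      using assms(3) MT by (intro bexI[of _ a]) (auto simp: hull_inc dest: subset_antisym)
  next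
    case False
    have "T \<subseteq> convex hull M \<union> convex hull (T - M)"
      using hull_subset[of M convex] hull_subset[of "T - M" convex] by blast
    then have "a \<in> convex hull (convex hull M \<union> convex hull (T - M))"
      using assms(3) hull_mono by blast
    then obtain m r u v where "m \<in> convex hull M" "r \<in> convex hull (T - M)"
        "0 \<le> u" "0 \<le> v" "u + v = 1" "a = u *\<^sub>R m + v *\<^sub>R r"
      using convex_hull_union_two[of "convex hull M" "convex hull (T - M)"] \<open>M \<noteq> {}\<close> False
      by auto
    moreover have "r \<in> convex hull (insert m (T - M))"
      using hull_mono[of "T - M" "insert m (T - M)" convex] calculation by blast
    ultimately show ?thesis
      by (metis convexD convex_convex_hull hull_inc insertI1)
  qed
  then obtain m where m: "m \<in> convex hull M" "a \<in> convex hull (insert m (T - M))"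
    by blast
  obtain t where t: "t \<in> M" "m \<in> convex hull (insert c (M - {t}))"
    using in_convex_hull_exchange[OF c(1) m(1)] by blast
  let ?H = "convex hull (insert b (T - {t}))"
  \<comment> \<open>As \<open>t\<close> is in \<open>M\<close>, it is not in \<open>P\<close>, so
    \<open>P\<close> survives the removal of \<open>t\<close>.\<close>
  have "P \<subseteq> insert b (T - {t})"
    using MP t by blast
  then have "c \<in> ?H"
    using c(2) hull_mono by blast
  then have "insert c (M - {t}) \<subseteq> ?H"
    using MT by (auto intro: hull_inc)
  then have "m \<in> ?H"
    using t(2) subset_hull[where S = convex, OF convex_convex_hull] by blast
  then have "insert m (T - M) \<subseteq> ?H"
    using t(1) by (auto intro: hull_inc)
  then have "a \<in> ?H"
    using m(2) subset_hull[where S = convex, OF convex_convex_hull] by blast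
  then show ?thesis
    using that t(1) MT by blast
qed

text \<open>Caratheodory gives at most \<open>DIM('a) + 1\<close> points; if there are that many,
  trading one for \<open>b\<close> leaves \<open>DIM('a)\<close> of them beside
  \<open>b\<close>.\<close>

lemma caratheodory_insert:
  fixes a b :: "'a::euclidean_space"
  assumes "a \<in> convex hull U"
  obtains T where "finite T" "T \<subseteq> U" "card T \<le> DIM('a)" "a \<in> convex hull (insert b T)"
proof -
  obtain T where T: "finite T" "T \<subseteq> U" "card T \<le> DIM('a) + 1" "a \<in> convex hull T"
    using assms by (auto simp: caratheodory[of U])
  show ?thesis
  proof (cases "card T \<le> DIM('a)")
    case True
    then show ?thesis
      using that T hull_mono[of T "insert b T" convex] by blast
  next
    case False
    then obtain t where t: "t \<in> T" "a \<in> convex hull (insert b (T - {t}))"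
      using in_convex_hull_exchange_any[of T a b] T by auto
    show ?thesis
    proof (rule that)
      show "card (T - {t}) \<le> DIM('a)"
        using T(1,3) t(1) by simp
    qed (use T t in auto)
  qed
qed

lemma in_convex_hull_UN_omit:
  fixes y :: "'i \<Rightarrow> 'a::euclidean_space set"
  assumes "finite I" "DIM('a) < card I" "a \<in> convex hull (\<Union>i\<in>I. y i)"
    and b: "\<And>i. i \<in> I \<Longrightarrow> b \<in> convex hull (\<Union>j\<in>I - {i}. y j)"
  obtains i where "i \<in> I" "a \<in> convex hull (\<Union>j\<in>I - {i}. y j)"
proof -
  obtain T where T: "finite T" "T \<subseteq> (\<Union>i\<in>I. y i)" "card T \<le> DIM('a)"
      "a \<in> convex hull (insert b T)"
    using caratheodory_insert[OF assms(3)] by blast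
  then obtain f where f: "\<And>t. t \<in> T \<Longrightarrow> f t \<in> I \<and> t \<in> y (f t)"
    by (metis UN_E subsetD)
  have "card (f ` T) < card I"
    using card_image_le[OF T(1), of f] T(3) assms(2) by linarith
  then obtain i where i: "i \<in> I" "i \<notin> f ` T"
    by (metis T(1) card_mono finite_imageI not_le subsetI)
  have "T \<subseteq> (\<Union>j\<in>I - {i}. y j)"
    using f i by blast
  then have "insert b T \<subseteq> convex hull (\<Union>j\<in>I - {i}. y j)"
    using b[OF i(1)] hull_subset[of "\<Union>j\<in>I - {i}. y j" convex] by auto
  then show ?thesis
    using that[OF i(1)] T(4) subset_hull[where S = convex, OF convex_convex_hull] by blast
qed

text \<open>One treatment serves both claims: \<open>a\<close> becomes \<open>{p}\<close> for the
  sublattice and \<open>{}\<close> for the full lattice.\<close>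

context
  fixes S a x :: "'a::euclidean_space set" and y :: "nat \<Rightarrow> 'a set" and n :: nat
  assumes n: "n \<ge> 1"
    and x: "x \<in> carrier (RelConv_ge S a)"
    and y: "y \<in> {1..n+1} \<rightarrow> carrier (RelConv_ge S a)"
begin

private lemma SSUP_y:
  assumes "J \<subseteq> {1..n+1}" "J \<noteq> {}"
  shows "(SSUP\<^bsub>RelConv_ge S a\<^esub> j:J. y j) = convex hull (\<Union>j\<in>J. y j) \<inter> S"
    and "(SSUP\<^bsub>RelConv_ge S a\<^esub> j:J. y j) \<in> carrier (RelConv_ge S a)"
proof -
  have sub: "y ` J \<subseteq> carrier (RelConv_ge S a)"
    using assms y by blast
  then show "(SSUP\<^bsub>RelConv_ge S a\<^esub> j:J. y j) = convex hull (\<Union>j\<in>J. y j) \<inter> S"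
    using sup_RelConv_ge[of "y ` J"] assms by (simp add: supr_def)
  show "(SSUP\<^bsub>RelConv_ge S a\<^esub> j:J. y j) \<in> carrier (RelConv_ge S a)"
    using least_RelConv_ge[OF sub] sup_RelConv_ge[OF sub] assms(2)
    by (auto simp: least_def Upper_def supr_def)
qed

text \<open>The hull formula for joins is stated for nonempty families; \<open>n \<ge> 1\<close>
  ensures that 1 or 2 remains.\<close>

private lemma nonempty_omit: "{1..n+1} - {i} \<noteq> {}"
proof -
  have "1 \<in> {1..n+1} - {i} \<or> 2 \<in> {1..n+1} - {i}"
    using n by auto
  then show ?thesis by blast
qed

lemma D_lhs_RelConv_ge:
  "D_lhs (RelConv_ge S a) n x y = x \<inter> (convex hull (\<Union>i\<in>{1..n+1}. y i) \<inter> S)"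
  using SSUP_y[of "{1..n+1}"] n meet_RelConv_ge[OF x] unfolding D_lhs_def by simp

lemma D_lhs_RelConv_ge_closed: "D_lhs (RelConv_ge S a) n x y \<in> carrier (RelConv_ge S a)"
  using D_lhs_RelConv_ge SSUP_y[of "{1..n+1}"] x rel_convex_Int[of S x] n
  by (auto simp: carrier_RelConv_ge)

private lemma meet_omit:
  shows "x \<sqinter>\<^bsub>RelConv_ge S a\<^esub> (SSUP\<^bsub>RelConv_ge S a\<^esub> j:{1..n+1} - {i}. y j) =
      x \<inter> (convex hull (\<Union>j\<in>{1..n+1} - {i}. y j) \<inter> S)"
    and "x \<inter> (convex hull (\<Union>j\<in>{1..n+1} - {i}. y j) \<inter> S) \<in> carrier (RelConv_ge S a)"
  using SSUP_y[OF _ nonempty_omit] meet_RelConv_ge[OF x] x rel_convex_Int[of S x]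
  by (auto simp: carrier_RelConv_ge)

lemma D_rhs_RelConv_ge:
  "D_rhs (RelConv_ge S a) n x y =
    convex hull (\<Union>i\<in>{1..n+1}. x \<inter> (convex hull (\<Union>j\<in>{1..n+1} - {i}. y j) \<inter> S)) \<inter> S"
  unfolding D_rhs_def supr_def meet_omit(1)[unfolded supr_def] by (subst sup_RelConv_ge) (use meet_omit(2) in auto)

lemma D_rhs_RelConv_ge_closed: "D_rhs (RelConv_ge S a) n x y \<in> carrier (RelConv_ge S a)"
proof -
  \<comment> \<open>Every joined term contains \<open>a\<close>; the one for index 1 is
    picked.\<close>
  have "a \<subseteq> x \<inter> (convex hull (\<Union>j\<in>{1..n+1} - {1}. y j) \<inter> S)"
    using meet_omit(2)[of 1] by (simp add: carrier_RelConv_ge)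
  also have "\<dots> \<subseteq> (\<Union>i\<in>{1..n+1}. x \<inter> (convex hull (\<Union>j\<in>{1..n+1} - {i}. y j) \<inter> S))"
    by (rule UN_upper) auto
  finally show ?thesis
    using x hull_subset unfolding D_rhs_RelConv_ge carrier_RelConv_ge
    by (auto simp: rel_convex_hull intro: hull_inc)
qed

lemma D_lhs_eq_D_rhs:
  assumes "n = DIM('a)" and b: "b \<in> y 1" "b \<in> y 2"
  shows "D_lhs (RelConv_ge S a) n x y = D_rhs (RelConv_ge S a) n x y"
proof
  \<comment> \<open>At most one of the indices 1 and 2 is omitted, and both of their sets contain
    \<open>b\<close>.\<close>
  have "b \<in> convex hull (\<Union>j\<in>{1..n+1} - {i}. y j)" for i
  proof (rule hull_inc)
    show "b \<in> (\<Union>j\<in>{1..n+1} - {i}. y j)"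
      using n b by (cases "i = 1") force+
  qed
  then have "\<exists>i\<in>{1..n+1}. q \<in> convex hull (\<Union>j\<in>{1..n+1} - {i}. y j)"
    if "q \<in> convex hull (\<Union>i\<in>{1..n+1}. y i)" for q
    using in_convex_hull_UN_omit[of "{1..n+1}" q y b] that assms(1)
    by (metis One_nat_def Suc_eq_plus1 card_atLeastAtMost diff_Suc_1 finite_atLeastAtMost lessI)
  then show "D_lhs (RelConv_ge S a) n x y \<subseteq> D_rhs (RelConv_ge S a) n x y"
    unfolding D_lhs_RelConv_ge D_rhs_RelConv_ge by (auto intro!: hull_inc)
  \<comment> \<open>This inclusion holds in any lattice: each joined term lies below the left side,
    hence so does the join.\<close>
  have "(\<Union>i\<in>{1..n+1}. x \<inter> (convex hull (\<Union>j\<in>{1..n+1} - {i}. y j) \<inter> S))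
      \<subseteq> D_lhs (RelConv_ge S a) n x y"
    unfolding D_lhs_RelConv_ge
    by (intro UN_least Int_mono hull_mono UN_mono) auto
  then have "convex hull (\<Union>i\<in>{1..n+1}. x \<inter> (convex hull (\<Union>j\<in>{1..n+1} - {i}. y j) \<inter> S))
      \<subseteq> convex hull (D_lhs (RelConv_ge S a) n x y)"
    by (rule hull_mono)
  then show "D_rhs (RelConv_ge S a) n x y \<subseteq> D_lhs (RelConv_ge S a) n x y"
    using D_lhs_RelConv_ge_closed
    unfolding D_rhs_RelConv_ge carrier_RelConv_ge rel_convex_def by blast
qed

end

theorem proposition25:
  fixes S :: "(real ^ 'n) set"
  shows "satisfies_D_join_meet (RelConv S) CARD('n) \<and>
    (\<forall>p \<in> S. satisfies_D (RelConv_ge S {p}) CARD('n))"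
proof (intro conjI ballI)
  let ?n = "CARD('n)"
  have n: "?n \<ge> 1" "?n = DIM(real ^ 'n)"
    by (simp_all add: Suc_leI)
  show "satisfies_D (RelConv_ge S {p}) ?n" for p
    unfolding satisfies_D_def
  proof (intro ballI)
    fix x y
    assume x: "x \<in> carrier (RelConv_ge S {p})"
      and y: "y \<in> {1..?n+1} \<rightarrow> carrier (RelConv_ge S {p})"
    have "p \<in> y i" if "i \<in> {1..?n+1}" for i
      using y that by (auto simp: carrier_RelConv_ge Pi_iff)
    then have "p \<in> y 1" "p \<in> y 2"
      using n(1) by auto
    then show "D_lhs (RelConv_ge S {p}) ?n x y = D_rhs (RelConv_ge S {p}) ?n x y"
      by (rule D_lhs_eq_D_rhs[OF n(1) x y n(2)])
  qed
  let ?L = "RelConv_ge S {}"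
  have "satisfies_D_join_meet ?L ?n"
    unfolding satisfies_D_join_meet_def
  proof (intro ballI)
    fix x y z
    assume x: "x \<in> carrier ?L" and y: "y \<in> {1..?n+1} \<rightarrow> carrier ?L" and z: "z \<in> carrier ?L"
    have y12: "y 1 \<in> carrier ?L" "y 2 \<in> carrier ?L"
      using y n(1) by auto
    interpret lattice ?L
      by (rule lattice_RelConv_ge)
    show "(D_lhs ?L ?n x y \<squnion>\<^bsub>?L\<^esub> z) \<sqinter>\<^bsub>?L\<^esub> y 1 \<sqinter>\<^bsub>?L\<^esub> y 2 =
        (D_rhs ?L ?n x y \<squnion>\<^bsub>?L\<^esub> z) \<sqinter>\<^bsub>?L\<^esub> y 1 \<sqinter>\<^bsub>?L\<^esub> y 2"
    proof (cases "y 1 \<inter> y 2 = {}")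
      case True
      have "w \<sqinter>\<^bsub>?L\<^esub> y 1 \<sqinter>\<^bsub>?L\<^esub> y 2 = {}" if "w \<in> carrier ?L" for w
        using that y12 True meet_closed[OF that y12(1)]
        by (auto simp: meet_RelConv_ge)
      then show ?thesis
        using D_lhs_RelConv_ge_closed[OF n(1) x y] D_rhs_RelConv_ge_closed[OF n(1) x y] z
        by simp
    next
      case False
      \<comment> \<open>Here the two sides of D_n agree even before \<open>z\<close> is
        joined.\<close>
      then show ?thesis
        using D_lhs_eq_D_rhs[OF n(1) x y n(2)] by auto
    qed
  qed
  then show "satisfies_D_join_meet (RelConv S) ?n"
    by (simp add: RelConv_ge_empty)
qed

end
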